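(* For every interval $k$-graph $G$ with maximum degree $\Delta$ and multiplicity $\mu$, $$\chi(G^2)\le\max\{2\Delta-1,\ \Delta+\mu\}\le 2\Delta.$$
   Context: All graphs are simple. For a graph $G=(V,E)$: $N_G(v)$ is the set of neighbors of $v$; $\Delta$ is the maximum degree; the multiplicity is $\mu=\max\{|N_G(u)\cap N_G(v)|: u,v\in V,\ u\ne v\}$; $\chi$ denotes the chromatic number. The square $G^2$ is the graph on $V$ in which two distinct vertices are adjacent iff their distance in $G$ is at most $2$. $G$ is an interval $k$-graph if each vertex $v$ can be assigned a pair $(I_v,\kappa(v))$, with $I_v$ a closed interval of the real line and $\kappa(v)\in\{1,\dots,k\}$, so that $uv\in E$ iff $I_u\cap I_v\neq\emptyset$ and $\kappa(u)\ne\kappa(v)$.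
   Formalization: Graphs are finite; the first inequality is stated only for Δ ≥ 2, since it fails for nonempty graphs with Δ ≤ 1 (e.g. K₂: χ(G²)=2, bound 1); max ≤ 2Δ is kept for all Δ, and χ(G²) ≤ 2Δ for Δ ≥ 1. *)

theory Defs
  imports Complex_Main "HOL-Library.Extended_Nat" "HOL-Library.FuncSet"
begin

definition simple_graph :: "'a set \<Rightarrow> 'a set set \<Rightarrow> bool" where
  "simple_graph V E \<longleftrightarrow> finite V \<and> (\<forall>e\<in>E. e \<subseteq> V \<and> card e = 2)"

definition neighbors :: "'a set set \<Rightarrow> 'a \<Rightarrow> 'a set" where
  "neighbors E v = {w. {v, w} \<in> E}"

text \<open>On \<open>nat\<close>, the supremum of a finite nonempty set is its maximum, and
  the supremum of the empty set is 0. The latter matters only for graphs with no vertices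
  (maximum degree) or with at most one vertex (multiplicity).\<close>

definition max_degree :: "'a set \<Rightarrow> 'a set set \<Rightarrow> nat" where
  "max_degree V E = (SUP v\<in>V. card (neighbors E v))"

definition multiplicity :: "'a set \<Rightarrow> 'a set set \<Rightarrow> nat" where
  "multiplicity V E =
     Sup {card (neighbors E u \<inter> neighbors E v) | u v. u \<in> V \<and> v \<in> V \<and> u \<noteq> v}"

text \<open>The \<open>n\<close>-th relational power of adjacency relates the endpoints of walks of length
  \<open>n\<close>; the distance is infinite if there is no walk.\<close>

definition graph_dist :: "'a set set \<Rightarrow> 'a \<Rightarrow> 'a \<Rightarrow> enat" where
  "graph_dist E u v = (INF n\<in>{n. (u, v) \<in> {(x, y). {x, y} \<in> E} ^^ n}. enat n)"

definition graph_square :: "'a set \<Rightarrow> 'a set set \<Rightarrow> 'a set set" where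
  "graph_square V E = {{u, v} | u v. u \<in> V \<and> v \<in> V \<and> u \<noteq> v \<and> graph_dist E u v \<le> 2}"

definition proper_coloring :: "'a set \<Rightarrow> 'a set set \<Rightarrow> nat \<Rightarrow> ('a \<Rightarrow> nat) \<Rightarrow> bool" where
  "proper_coloring V E m c \<longleftrightarrow> c \<in> V \<rightarrow> {..<m} \<and> (\<forall>u v. {u, v} \<in> E \<longrightarrow> c u \<noteq> c v)"

definition chromatic_number :: "'a set \<Rightarrow> 'a set set \<Rightarrow> nat" where
  "chromatic_number V E = (LEAST m. \<exists>c. proper_coloring V E m c)"

text \<open>Pitfall: for an interval \<open>k\<close>-graph with a vertex, the bound
  \<open>\<chi>(G\<^sup>2) \<le> max {2\<Delta> - 1, \<Delta> + \<mu>}\<close> is false when \<open>\<Delta> \<le> 1\<close>: if \<open>\<Delta> = 1\<close> (for example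
  the complete graph on two vertices) then \<open>\<mu> = 0\<close> and \<open>\<chi>(G\<^sup>2) = 2\<close>, but the maximum
  is 1; if \<open>\<Delta> = 0\<close> then \<open>\<chi>(G\<^sup>2) = 1\<close>, but the maximum is 0, and also \<open>2\<Delta> = 0\<close>.\<close>

definition interval_k_graph :: "nat \<Rightarrow> 'a set \<Rightarrow> 'a set set \<Rightarrow> bool" where
  "interval_k_graph k V E \<longleftrightarrow> simple_graph V E \<and>
     (\<exists>(l :: 'a \<Rightarrow> real) (r :: 'a \<Rightarrow> real) (\<kappa> :: 'a \<Rightarrow> nat).
        (\<forall>v\<in>V. l v \<le> r v \<and> \<kappa> v \<in> {1..k}) \<and>
        (\<forall>u\<in>V. \<forall>v\<in>V. {u, v} \<in> E \<longleftrightarrow>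
           {l u..r u} \<inter> {l v..r v} \<noteq> {} \<and> \<kappa> u \<noteq> \<kappa> v))"

end

theory Submission
  imports Defs
begin

text \<open>The square is coloured greedily: every nonempty vertex set \<open>R\<close> contains a vertex with
  few \<open>R\<close>-vertices at distance at most 2 from it. Let \<open>v \<in> R\<close> have the leftmost right endpoint \<open>p\<close>,
  let \<open>A = N(v) \<inter> R\<close>, all of whose intervals contain \<open>p\<close>, and let \<open>w\<close> be the neighbour of \<open>v\<close>
  reaching furthest to the right. The \<open>R\<close>-vertices at distance at most 2 from \<open>v\<close> whose class
  differs from that of \<open>w\<close> are neighbours of \<open>w\<close>. If \<open>v\<close> has a neighbour beyond \<open>p\<close> of another
  class than \<open>w\<close>, let \<open>w'\<close> be the furthest reaching one: it is adjacent to all those that remain,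
  and as \<open>v, w, w'\<close> form a triangle the total is at most \<open>2\<Delta> - 2\<close>. Otherwise all those
  that remain lie in \<open>A\<close>, and the total is at most \<open>\<Delta> - 1 + |A|\<close>. Finally, if \<open>|A| > \<mu>\<close>, then
  the vertex of \<open>A\<close> with the leftmost right endpoint has at most \<open>\<Delta>\<close> such vertices, since any
  neighbour of it other than \<open>v\<close> that reaches \<open>p\<close> would be adjacent to all of \<open>A\<close>.\<close>

section \<open>Distance two in terms of neighbourhoods\<close>

definition within_two :: "'a set set \<Rightarrow> 'a \<Rightarrow> 'a set" where
  "within_two E v = (neighbors E v \<union> (\<Union>w\<in>neighbors E v. neighbors E w)) - {v}"

lemma neighbors_sym: "u \<in> neighbors E v \<longleftrightarrow> v \<in> neighbors E u"
  by (simp add: neighbors_def insert_commute)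

lemma within_two_sym: "u \<in> within_two E v \<longleftrightarrow> v \<in> within_two E u"
  unfolding within_two_def using neighbors_sym[of _ E] by blast

text \<open>If all walks had length 3 or more, so would their infimum; hence some walk has length 0,
  1 or 2. One implication suffices: a colouring that separates extra pairs is still proper.\<close>

lemma graph_dist_le_2_within_two:
  assumes "graph_dist E u v \<le> 2" "u \<noteq> v"
  shows "v \<in> within_two E u"
proof -
  let ?W = "\<lambda>n. (u, v) \<in> {(x, y). {x, y} \<in> E} ^^ n"
  have "\<exists>n. ?W n \<and> n \<le> 2"
  proof (rule ccontr)
    assume "\<nexists>n. ?W n \<and> n \<le> 2"
    then have "3 \<le> n" if "?W n" for n
      using that by (metis One_nat_def Suc_1 not_less_eq_eq numeral_3_eq_3)
    then have "enat 3 \<le> graph_dist E u v"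
      unfolding graph_dist_def by (intro INF_greatest) simp
    with assms(1) have "enat 3 \<le> enat 2"
      by (metis numeral_eq_enat order.trans)
    then show False by simp
  qed
  then obtain n where n: "?W n" "n \<le> 2" by blast
  then consider "n = 0" | "n = 1" | "n = 2" by linarith
  then show ?thesis
  proof cases
    case 1
    with n assms show ?thesis by simp
  next
    case 2
    with n assms show ?thesis by (simp add: within_two_def neighbors_def)
  next
    case 3
    with n have "(u, v) \<in> {(x, y). {x, y} \<in> E} O {(x, y). {x, y} \<in> E}"
      by (simp add: numeral_2_eq_2)
    with assms show ?thesis by (auto simp: within_two_def neighbors_def)
  qed
qed

section \<open>Greedy colouring\<close>

text \<open>Delete a sparse vertex, colour the rest by induction, and note that fewer than
  \<open>m\<close> conflicts leave a colour free. Sparseness is assumed for every \<open>R\<close>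
  so that it survives the deletion.\<close>

lemma greedy_coloring:
  fixes m :: nat
  assumes "finite V"
    and "\<And>u v. u \<in> Q v \<longleftrightarrow> v \<in> Q u"
    and "\<And>R. R \<subseteq> V \<Longrightarrow> R \<noteq> {} \<Longrightarrow> \<exists>v\<in>R. card (R \<inter> Q v - {v}) < m"
  shows "\<exists>c. c \<in> V \<rightarrow> {..<m} \<and> (\<forall>u\<in>V. \<forall>v\<in>V. u \<noteq> v \<longrightarrow> u \<in> Q v \<longrightarrow> c u \<noteq> c v)"
  using assms(1,3)
proof (induction "card V" arbitrary: V)
  case 0
  then show ?case by simp
next
  case (Suc n)
  then have "V \<noteq> {}" by auto
  with Suc.prems obtain v where v: "v \<in> V" "card (V \<inter> Q v - {v}) < m" by blast
  obtain c where c: "c \<in> V - {v} \<rightarrow> {..<m}"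
      "\<forall>x\<in>V - {v}. \<forall>y\<in>V - {v}. x \<noteq> y \<longrightarrow> x \<in> Q y \<longrightarrow> c x \<noteq> c y"
  proof -
    have "n = card (V - {v})" using Suc.hyps(2) v by simp
    then have "\<exists>c. c \<in> V - {v} \<rightarrow> {..<m} \<and>
        (\<forall>x\<in>V - {v}. \<forall>y\<in>V - {v}. x \<noteq> y \<longrightarrow> x \<in> Q y \<longrightarrow> c x \<noteq> c y)"
      using Suc.prems by (intro Suc.hyps(1)) (simp_all add: subset_Diff_insert)
    with that show thesis by blast
  qed
  have "card (c ` (V \<inter> Q v - {v})) < card {..<m}"
    using v(2) card_image_le[of "V \<inter> Q v - {v}" c] Suc.prems(1) by simp
  then have "\<not> {..<m} \<subseteq> c ` (V \<inter> Q v - {v})"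
    using Suc.prems(1) by (meson card_mono finite_Diff finite_Int finite_imageI not_less)
  then obtain i where i: "i < m" "i \<notin> c ` (V \<inter> Q v - {v})" by blast
  have new: "c u \<noteq> i" if "u \<in> V" "u \<noteq> v" "u \<in> Q v \<or> v \<in> Q u" for u
    using that i(2) assms(2) by blast
  show ?case
  proof (intro exI[of _ "c(v := i)"] conjI ballI impI)
    show "c(v := i) \<in> V \<rightarrow> {..<m}" using c(1) i(1) by auto
  next
    fix x y assume "x \<in> V" "y \<in> V" "x \<noteq> y" "x \<in> Q y"
    then show "(c(v := i)) x \<noteq> (c(v := i)) y"
      using c(2) new[of x] new[of y] by (cases "x = v"; cases "y = v") auto
  qed
qed

lemma finite_obtain_argmin:
  fixes f :: "'a \<Rightarrow> real"
  assumes "finite A" "A \<noteq> {}"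
  obtains x where "x \<in> A" "\<And>y. y \<in> A \<Longrightarrow> f x \<le> f y"
  using that arg_min_if_finite(1)[OF assms] arg_min_least[OF assms] by blast

lemma finite_obtain_argmax:
  fixes f :: "'a \<Rightarrow> real"
  assumes "finite A" "A \<noteq> {}"
  obtains x where "x \<in> A" "\<And>y. y \<in> A \<Longrightarrow> f y \<le> f x"
  using finite_obtain_argmin[OF assms, of "\<lambda>x. - f x"] that by auto

lemma chromatic_number_square_le:
  assumes "finite V"
    and "\<And>R. R \<subseteq> V \<Longrightarrow> R \<noteq> {} \<Longrightarrow> \<exists>v\<in>R. card (R \<inter> within_two E v) < m"
  shows "chromatic_number V (graph_square V E) \<le> m"
proof -
  have "within_two E v - {v} = within_two E v" for v by (auto simp: within_two_def)
  then have "\<exists>c. c \<in> V \<rightarrow> {..<m} \<and>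
      (\<forall>u\<in>V. \<forall>v\<in>V. u \<noteq> v \<longrightarrow> u \<in> within_two E v \<longrightarrow> c u \<noteq> c v)"
    using assms by (intro greedy_coloring within_two_sym) (simp_all add: Int_Diff)
  then obtain c where c: "c \<in> V \<rightarrow> {..<m}"
      "\<forall>u\<in>V. \<forall>v\<in>V. u \<noteq> v \<longrightarrow> u \<in> within_two E v \<longrightarrow> c u \<noteq> c v"
    by blast
  have "c u \<noteq> c v" if uv: "{u, v} \<in> graph_square V E" for u v
  proof -
    obtain x y where xy: "{u, v} = {x, y}" "x \<in> V" "y \<in> V" "x \<noteq> y" "graph_dist E x y \<le> 2"
      using uv unfolding graph_square_def by blast
    then have "c x \<noteq> c y"
      using c(2) graph_dist_le_2_within_two[of E x y] by metis
    with xy(1) show ?thesis by (auto simp: doubleton_eq_iff)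
  qed
  with c(1) have "proper_coloring V (graph_square V E) m c"
    unfolding proper_coloring_def by blast
  then show ?thesis unfolding chromatic_number_def by (intro Least_le) blast
qed

section \<open>Degree and multiplicity bounds\<close>

locale finite_simple_graph =
  fixes V :: "'a set" and E :: "'a set set"
  assumes simple: "simple_graph V E"
begin

lemma finite_V: "finite V"
  using simple by (simp add: simple_graph_def)

lemma neighbors_subset: "neighbors E v \<subseteq> V"
  using simple by (auto simp: simple_graph_def neighbors_def)

lemma neighbor_in_V: "w \<in> neighbors E v \<Longrightarrow> v \<in> V"
  using neighbors_subset neighbors_sym by fast

lemma finite_neighbors: "finite (neighbors E v)"
  using neighbors_subset finite_V finite_subset by blast

lemma card_neighbors_le: "card (neighbors E v) \<le> max_degree V E"
proof (cases "v \<in> V")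
  case True
  then show ?thesis
    unfolding max_degree_def using finite_V by (intro cSUP_upper) auto
next
  case False
  then have "neighbors E v = {}" using neighbor_in_V by blast
  then show ?thesis by simp
qed

lemma card_common_neighbors_le:
  assumes "u \<in> V" "v \<in> V" "u \<noteq> v"
  shows "card (neighbors E u \<inter> neighbors E v) \<le> multiplicity V E"
proof -
  have "finite ((\<lambda>(u, v). card (neighbors E u \<inter> neighbors E v)) ` (V \<times> V))"
    using finite_V by simp
  then have "finite {card (neighbors E u \<inter> neighbors E v) | u v. u \<in> V \<and> v \<in> V \<and> u \<noteq> v}"
    by (rule rev_finite_subset) auto
  then show ?thesis
    unfolding multiplicity_def using assms by (intro cSup_upper) (auto intro: bdd_above_finite)
qed

lemma multiplicity_le_max_degree: "multiplicity V E \<le> max_degree V E"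
proof -
  let ?M = "{card (neighbors E u \<inter> neighbors E v) | u v. u \<in> V \<and> v \<in> V \<and> u \<noteq> v}"
  have bound: "x \<le> max_degree V E" if "x \<in> ?M" for x
    using that card_neighbors_le finite_neighbors
    by (auto intro!: order.trans[OF card_mono card_neighbors_le])
  show ?thesis
  proof (cases "?M = {}")
    case True
    \<comment> \<open>With at most one vertex there are no pairs, and the supremum of the empty set
      is 0.\<close>
    show ?thesis unfolding multiplicity_def True by simp
  next
    case False
    then show ?thesis unfolding multiplicity_def by (rule cSup_least) (rule bound)
  qed
qed

text \<open>The middle vertex of a path of length two would have degree 2. This serves the case in
  which the sharper bound fails.\<close>

lemma card_within_two_le_1:
  assumes "max_degree V E = 1"
  shows "card (within_two E v) \<le> 1"
proof -
  have "within_two E v \<subseteq> neighbors E v"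
  proof
    fix u assume u: "u \<in> within_two E v"
    show "u \<in> neighbors E v"
    proof (rule ccontr)
      assume "u \<notin> neighbors E v"
      then obtain w where w: "w \<in> neighbors E v" "u \<in> neighbors E w" "u \<noteq> v"
        using u by (auto simp: within_two_def)
      then have "{u, v} \<subseteq> neighbors E w" using neighbors_sym by fast
      then have "card {u, v} \<le> card (neighbors E w)"
        using finite_neighbors card_mono by blast
      then show False using w assms card_neighbors_le[of w] by simp
    qed
  qed
  then have "card (within_two E v) \<le> card (neighbors E v)"
    using finite_neighbors card_mono by blast
  then show ?thesis using assms card_neighbors_le[of v] by simp
qed

end

section \<open>Sparse vertices in interval representations\<close>

locale interval_representation = finite_simple_graph V E
  for V :: "'a set" and E :: "'a set set" +
  fixes l r :: "'a \<Rightarrow> real" and \<kappa> :: "'a \<Rightarrow> nat"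
  assumes interval: "v \<in> V \<Longrightarrow> l v \<le> r v"
    and edge_iff: "u \<in> V \<Longrightarrow> v \<in> V \<Longrightarrow>
      {u, v} \<in> E \<longleftrightarrow> {l u..r u} \<inter> {l v..r v} \<noteq> {} \<and> \<kappa> u \<noteq> \<kappa> v"
begin

text \<open>As the intervals are nonempty, intersection reduces to two endpoint inequalities, which
  settle all later adjacencies by arithmetic.\<close>

lemma neighbors_iff:
  "w \<in> neighbors E v \<longleftrightarrow> v \<in> V \<and> w \<in> V \<and> l v \<le> r w \<and> l w \<le> r v \<and> \<kappa> v \<noteq> \<kappa> w"
proof (cases "v \<in> V \<and> w \<in> V")
  case True
  then have "{l v..r v} \<inter> {l w..r w} \<noteq> {} \<longleftrightarrow> l v \<le> r w \<and> l w \<le> r v"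
    using interval[of v] interval[of w] by auto
  with True show ?thesis using edge_iff[of v w] by (simp add: neighbors_def)
next
  case False
  then show ?thesis using neighbor_in_V neighbors_subset by blast
qed

lemma sparse_vertex:
  assumes R: "R \<subseteq> V" "R \<noteq> {}" and \<Delta>: "2 \<le> max_degree V E"
  shows "\<exists>x\<in>R. card (R \<inter> within_two E x)
    < max (2 * max_degree V E - 1) (max_degree V E + multiplicity V E)"
proof -
  let ?\<Delta> = "max_degree V E" and ?\<mu> = "multiplicity V E" and ?N = "neighbors E"
  have finR: "finite R" using R finite_V finite_subset by blast
  \<comment> \<open>For \<open>u\<close> in \<open>R\<close> and a neighbour \<open>y\<close> of
    \<open>v\<close>, this choice gives \<open>l y \<le> r v \<le> r u\<close>. Adjacency of
    \<open>y\<close> and \<open>u\<close> then only needs \<open>l u \<le> r y\<close> and distinct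
    classes.\<close>
  obtain v where v: "v \<in> R" and vmin: "\<And>u. u \<in> R \<Longrightarrow> r v \<le> r u"
    using finite_obtain_argmin[OF finR R(2), of r] by blast
  let ?S = "R \<inter> within_two E v"
  define A where "A = R \<inter> ?N v"
  show ?thesis
  proof (cases "?N v = {}")
    case True
    then show ?thesis using v \<Delta> by (intro bexI[of _ v]) (auto simp: within_two_def)
  next
    case False
    \<comment> \<open>The maximum is not restricted to \<open>R\<close>, because the middle vertex
      of a walk may lie outside \<open>R\<close>.\<close>
    then obtain w where w: "w \<in> ?N v" and wmax: "\<And>u. u \<in> ?N v \<Longrightarrow> r u \<le> r w"
      using finite_obtain_argmax[OF finite_neighbors, of v r] by blast
    define D where "D = {u \<in> ?S. \<kappa> u \<noteq> \<kappa> w}"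
    define T where "T = {u \<in> ?S. \<kappa> u = \<kappa> w}"
    have S: "?S = D \<union> T" by (auto simp: D_def T_def)
    have finDT: "finite D" "finite T" using finR by (auto simp: D_def T_def)
    have v_nbr: "v \<in> ?N w" using w neighbors_sym by fast
    have Dw: "D \<subseteq> ?N w - {v}"
    proof
      fix u assume "u \<in> D"
      then have u: "u \<in> R" "\<kappa> u \<noteq> \<kappa> w" "u \<noteq> v" "u \<in> within_two E v"
        by (auto simp: D_def within_two_def)
      have "l u \<le> r w \<and> l w \<le> r u"
      proof -
        have "l w \<le> r u" using w vmin[OF u(1)] by (auto simp: neighbors_iff)
        moreover have "l u \<le> r w"
        proof (cases "u \<in> ?N v")
          case True
          then show ?thesis
            using wmax[OF True] interval by (force simp: neighbors_iff)
        next
          case False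
          then obtain y where "y \<in> ?N v" "u \<in> ?N y" using u by (auto simp: within_two_def)
          then show ?thesis using wmax[of y] by (force simp: neighbors_iff)
        qed
        ultimately show ?thesis by simp
      qed
      with u w R show "u \<in> ?N w - {v}" by (auto simp: neighbors_iff)
    qed
    show ?thesis
    proof (cases "\<exists>y\<in>?N v. r v \<le> r y \<and> \<kappa> y \<noteq> \<kappa> w")
      case True
      \<comment> \<open>\<open>Y\<close> also admits intervals that end before \<open>r v\<close>:
        the middle vertex of a walk from \<open>v\<close> to a vertex of \<open>T\<close> may be
        one. By the case assumption the maximiser still reaches \<open>r v\<close>.\<close>
      define Y where "Y = {y \<in> ?N v. \<kappa> y \<noteq> \<kappa> w}"
      have "finite Y" "Y \<noteq> {}" using True finite_neighbors by (auto simp: Y_def)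
      then obtain w' where w': "w' \<in> Y" and w'max: "\<And>u. u \<in> Y \<Longrightarrow> r u \<le> r w'"
        using finite_obtain_argmax[of Y r] by blast
      have rw': "r v \<le> r w'" using True w'max by (force simp: Y_def)
      have rw: "r v \<le> r w" using True wmax by force
      have ww': "w' \<in> ?N w" using w w' rw rw' by (auto simp: Y_def neighbors_iff)
      have Tw': "T \<subseteq> ?N w'"
      proof
        fix u assume "u \<in> T"
        then have u: "u \<in> R" "\<kappa> u = \<kappa> w" "u \<in> within_two E v"
          by (auto simp: T_def)
        have "l w' \<le> r u" using w' vmin[OF u(1)] by (auto simp: Y_def neighbors_iff)
        moreover have "l u \<le> r w'"
        proof (cases "u \<in> ?N v")
          case True
          then show ?thesis using rw' by (auto simp: neighbors_iff)
        next
          case False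
          then obtain y where y: "y \<in> ?N v" "u \<in> ?N y" using u by (auto simp: within_two_def)
          then have "y \<in> Y" using u by (auto simp: Y_def neighbors_iff)
          then show ?thesis using w'max[of y] y by (force simp: neighbors_iff)
        qed
        ultimately show "u \<in> ?N w'" using u w' R by (auto simp: Y_def neighbors_iff)
      qed
      \<comment> \<open>\<open>w'\<close> lies in \<open>D\<close> only if it is in
        \<open>R\<close>. Counting \<open>v\<close>, \<open>w'\<close> and \<open>D - {w'}\<close>
        inside the neighbourhood of \<open>w\<close> gives \<open>card D \<le> \<Delta> - 1\<close>
        either way; \<open>T\<close> and \<open>w\<close> are treated alike below, inside the
        neighbourhood of \<open>w'\<close>.\<close>
      have "insert v (insert w' D) \<subseteq> ?N w" "v \<notin> insert w' (D - {w'})"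
        using Dw v_nbr ww' w' by (auto simp: Y_def neighbors_iff)
      then have "card (insert v (insert w' (D - {w'}))) \<le> ?\<Delta>"
        by (intro order.trans[OF card_mono[OF finite_neighbors] card_neighbors_le]) auto
      with \<open>v \<notin> insert w' (D - {w'})\<close> have D1: "card (D - {w'}) + 2 \<le> ?\<Delta>"
        using finDT by (simp add: card.insert_remove)
      have "v \<notin> T" by (auto simp: T_def within_two_def)
      moreover have "v \<noteq> w" using w by (auto simp: neighbors_iff)
      moreover have "insert v (insert w T) \<subseteq> ?N w'"
        using Tw' w' ww' neighbors_sym by (fastforce simp: Y_def)
      ultimately have "v \<notin> insert w (T - {w})" "insert v (insert w (T - {w})) \<subseteq> ?N w'"
        by auto
      then have "card (insert v (insert w (T - {w}))) \<le> ?\<Delta>"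
        by (intro order.trans[OF card_mono[OF finite_neighbors] card_neighbors_le])
      with \<open>v \<notin> insert w (T - {w})\<close> have T1: "card (T - {w}) + 2 \<le> ?\<Delta>"
        using finDT by (simp add: card.insert_remove)
      have "card D \<le> card (D - {w'}) + 1" "card T \<le> card (T - {w}) + 1"
        by (simp_all add: card_Diff_singleton_if) arith+
      then have "card ?S < 2 * ?\<Delta> - 1"
        using D1 T1 card_Un_le[of D T] unfolding S by linarith
      then show ?thesis using v by (intro bexI[of _ v]) auto
    next
      case False
      then have sameclass: "\<kappa> y = \<kappa> w" if "y \<in> ?N v" "r v \<le> r y" for y
        using that by blast
      have finA: "finite A" using finR by (simp add: A_def)
      \<comment> \<open>A middle vertex \<open>y\<close> towards \<open>u\<close> in
        \<open>T\<close> is not in the class of \<open>w\<close>, so it ends before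
        \<open>r v\<close>. Then \<open>l u \<le> r y < r v \<le> r u\<close>, and \<open>u\<close>
        meets \<open>v\<close> after all.\<close>
      have TA: "T \<subseteq> A"
      proof
        fix u assume "u \<in> T"
        then have u: "u \<in> R" "\<kappa> u = \<kappa> w" "u \<in> within_two E v" by (auto simp: T_def)
        show "u \<in> A"
        proof (rule ccontr)
          assume "u \<notin> A"
          then have nu: "u \<notin> ?N v" using u by (simp add: A_def)
          then obtain y where y: "y \<in> ?N v" "u \<in> ?N y" using u by (auto simp: within_two_def)
          then have "r y < r v" using sameclass[of y] u by (force simp: neighbors_iff)
          then have "u \<in> ?N v" using y u w vmin[OF u(1)] R interval[of v]
            by (auto simp: neighbors_iff)
          with nu show False ..
        qed
      qed
      show ?thesis
      proof (cases "card A \<le> ?\<mu>")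
        case True
        \<comment> \<open>The neighbour \<open>v\<close> of \<open>w\<close> lies outside
          \<open>D\<close>, which saves the 1 that makes the final inequality strict.\<close>
        have "insert v D \<subseteq> ?N w" "v \<notin> D" using Dw v_nbr by auto
        then have "card (insert v D) \<le> ?\<Delta>"
          by (intro order.trans[OF card_mono[OF finite_neighbors] card_neighbors_le])
        with \<open>v \<notin> D\<close> have "card D + 1 \<le> ?\<Delta>" using finDT by simp
        moreover have "card T \<le> ?\<mu>" using True TA finA card_mono order.trans by blast
        ultimately have "card ?S < ?\<Delta> + ?\<mu>" using card_Un_le[of D T] unfolding S by linarith
        then show ?thesis using v by (intro bexI[of _ v]) auto
      next
        case False
        then have "A \<noteq> {}" by auto
        then obtain a where a: "a \<in> A" and amin: "\<And>u. u \<in> A \<Longrightarrow> r a \<le> r u"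
          using finite_obtain_argmin[OF finA, of r] by blast
        have A_class: "\<kappa> u = \<kappa> w" if "u \<in> A" for u
          using that sameclass vmin by (auto simp: A_def)
        \<comment> \<open>For \<open>u\<close> in \<open>A\<close>,
          \<open>l u \<le> r v \<le> r x\<close> and \<open>l x \<le> r a \<le> r u\<close>. As
          \<open>A\<close> lies in one class, \<open>x\<close> is adjacent to all of
          \<open>A\<close>, giving more than \<open>\<mu>\<close> common neighbours with
          \<open>v\<close>.\<close>
        have only_v: "x = v" if x: "x \<in> ?N a" "r v \<le> r x" for x
        proof (rule ccontr)
          assume "x \<noteq> v"
          have "A \<subseteq> ?N x \<inter> ?N v"
          proof
            fix u assume u: "u \<in> A"
            then have "l u \<le> r x" using x by (auto simp: A_def neighbors_iff)
            moreover have "l x \<le> r u" using x amin[OF u] by (auto simp: neighbors_iff)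
            ultimately show "u \<in> ?N x \<inter> ?N v"
              using u x A_class[OF u] A_class[OF a] by (auto simp: A_def neighbors_iff)
          qed
          then have "card A \<le> card (?N x \<inter> ?N v)"
            using finite_neighbors by (intro card_mono) auto
          also have "\<dots> \<le> ?\<mu>"
            using x(1) v R \<open>x \<noteq> v\<close> neighbors_subset by (intro card_common_neighbors_le) auto
          finally show False using False by simp
        qed
        have "R \<inter> within_two E a \<subseteq> insert v (A - {a})"
        proof
          fix u assume u: "u \<in> R \<inter> within_two E a"
          show "u \<in> insert v (A - {a})"
          proof (cases "u \<in> ?N a")
            case True
            then show ?thesis using only_v vmin u by blast
          next
            case nadj: False
            then obtain y where y: "y \<in> ?N a" "u \<in> ?N y" "u \<noteq> a"
              using u by (auto simp: within_two_def)
            show ?thesis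
            proof (cases "r v \<le> r y")
              case True
              then show ?thesis using only_v[OF y(1)] y u by (auto simp: A_def)
            next
              case False
              \<comment> \<open>Now \<open>u\<close> and \<open>a\<close> both contain the point
                \<open>r v\<close>, so being nonadjacent they share a class; as \<open>a\<close> is
                adjacent to \<open>v\<close>, so is \<open>u\<close>.\<close>
              then have lu: "l u \<le> r v" using y by (auto simp: neighbors_iff)
              have ru: "r v \<le> r u" using u vmin by blast
              have "l a \<le> r v" "a \<in> R" using a by (auto simp: A_def neighbors_iff)
              then have "\<kappa> u = \<kappa> a"
                using nadj lu ru vmin[of a] u R by (auto simp: neighbors_iff)
              then have "u \<in> ?N v"
                using lu ru u R v a interval[of v] by (auto simp: A_def neighbors_iff)
              then show ?thesis using u y by (simp add: A_def)
            qed
          qed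
        qed
        then have "card (R \<inter> within_two E a) \<le> card (insert v (A - {a}))"
          using finA by (intro card_mono) auto
        also have "\<dots> \<le> card A"
          using a finA card_insert_le_m1[of "card A" "A - {a}" v] card_gt_0_iff[of A] by auto
        also have "\<dots> \<le> ?\<Delta>"
          using finite_neighbors
          by (intro order.trans[OF card_mono card_neighbors_le[of v]]) (auto simp: A_def)
        \<comment> \<open>\<open>\<Delta> < 2 * \<Delta> - 1\<close> uses
          \<open>2 \<le> \<Delta>\<close>.\<close>
        finally show ?thesis using \<Delta> a by (intro bexI[of _ a]) (auto simp: A_def)
      qed
    qed
  qed
qed

end

theorem corollary6:
  fixes V :: "'a set" and E :: "'a set set" and k :: nat
  assumes "interval_k_graph k V E"
  defines "\<Delta> \<equiv> max_degree V E" and "\<mu> \<equiv> multiplicity V E"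
    and "\<chi> \<equiv> chromatic_number V (graph_square V E)"
  shows "(2 \<le> \<Delta> \<longrightarrow> \<chi> \<le> max (2 * \<Delta> - 1) (\<Delta> + \<mu>)) \<and>
    max (2 * \<Delta> - 1) (\<Delta> + \<mu>) \<le> 2 * \<Delta> \<and>
    (1 \<le> \<Delta> \<longrightarrow> \<chi> \<le> 2 * \<Delta>)"
proof -
  obtain l r :: "'a \<Rightarrow> real" and \<kappa> :: "'a \<Rightarrow> nat" where
    "interval_representation V E l r \<kappa>"
    using assms(1) unfolding interval_k_graph_def
    by (force simp: interval_representation_def interval_representation_axioms_def
        finite_simple_graph_def)
  then interpret interval_representation V E l r \<kappa> .
  have main: "\<chi> \<le> max (2 * \<Delta> - 1) (\<Delta> + \<mu>)" if "2 \<le> \<Delta>"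
    using that finite_V sparse_vertex unfolding \<chi>_def \<Delta>_def \<mu>_def
    by (intro chromatic_number_square_le) auto
  have le: "max (2 * \<Delta> - 1) (\<Delta> + \<mu>) \<le> 2 * \<Delta>"
    using multiplicity_le_max_degree by (simp add: \<Delta>_def \<mu>_def)
  \<comment> \<open>Here the maximum is only 1, so \<open>2 * \<Delta>\<close> is reached directly:
    each vertex has at most one conflict, and two colours suffice.\<close>
  have "\<chi> \<le> 2 * \<Delta>" if "\<Delta> = 1"
    unfolding \<chi>_def
  proof (rule chromatic_number_square_le[OF finite_V])
    fix R assume "R \<subseteq> V" "R \<noteq> {}"
    then obtain x where "x \<in> R" by blast
    have "finite (within_two E x)" using finite_neighbors by (simp add: within_two_def)
    then have "card (R \<inter> within_two E x) \<le> card (within_two E x)" by (intro card_mono) auto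
    then show "\<exists>x\<in>R. card (R \<inter> within_two E x) < 2 * \<Delta>"
      using \<open>x \<in> R\<close> that card_within_two_le_1[of x] by (intro bexI[of _ x]) (auto simp: \<Delta>_def)
  qed
  moreover have "\<Delta> = 1 \<or> 2 \<le> \<Delta>" if "1 \<le> \<Delta>" using that by linarith
  ultimately show ?thesis using main le by (meson order.trans)
qed

end
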